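(* Let $Z_1,Z_2,\ldots$ be $1$-injective Banach spaces, let $X,Y$ be Banach spaces with $X\subset Y$ and $Y/X$ separable, and set $Z=(Z_j)_{c_0}$. Then for every non-zero bounded linear operator $T:X\to Z$ and every $\varepsilon>0$, there exists a bounded linear operator $\tilde T:Y\to Z$ extending $T$ with $\|\tilde T\|<(2+\varepsilon)\|T\|$.
   Context: $X\subset Y$ means that $X$ is a closed linear subspace of $Y$. A Banach space $Z$ is $\lambda$-injective if for arbitrary Banach spaces $X\subset Y$, every bounded linear operator $T:X\to Z$ has an extension $\tilde T:Y\to Z$ with $\|\tilde T\|\le\lambda\|T\|$. For Banach spaces $Z_1,Z_2,\ldots$, $(Z_j)_{c_0}$ is the space of all sequences $(z_j)$ with $z_j\in Z_j$ for all $j$ and $\|z_j\|\to0$, with norm $\|(z_j)\|=\sup_j\|z_j\|$. *)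

theory Defs
  imports "HOL-Analysis.Analysis" "HOL-Probability.Discrete_Topology"
begin

section \<open>Scalars, Banach spaces and operators\<close>

text \<open>
  The scalar field is \<open>\<real>\<close> or \<open>\<complex>\<close>; \<open>'k\<close> ranges over the normed fields isometrically isomorphic to
  one of them, so that both cases are covered by one statement.
\<close>

class real_or_complex = real_normed_field + banach +
  assumes ex_iso_real_or_complex:
    "\<exists>\<phi> :: 'a \<Rightarrow> complex. (\<forall>x y. \<phi> (x + y) = \<phi> x + \<phi> y) \<and> (\<forall>r x. \<phi> (r *\<^sub>R x) = r *\<^sub>R \<phi> x) \<and>
       (\<forall>x y. \<phi> (x * y) = \<phi> x * \<phi> y) \<and>
       (\<forall>x. norm (\<phi> x) = norm x) \<and> (range \<phi> = \<real> \<or> range \<phi> = UNIV)"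

instance real :: real_or_complex
proof
  show "\<exists>\<phi> :: real \<Rightarrow> complex. (\<forall>x y. \<phi> (x + y) = \<phi> x + \<phi> y) \<and> (\<forall>r x. \<phi> (r *\<^sub>R x) = r *\<^sub>R \<phi> x) \<and>
       (\<forall>x y. \<phi> (x * y) = \<phi> x * \<phi> y) \<and>
       (\<forall>x. norm (\<phi> x) = norm x) \<and> (range \<phi> = \<real> \<or> range \<phi> = UNIV)"
    by (rule exI[of _ complex_of_real])
       (auto simp: Reals_def scaleR_conv_of_real)
qed

instance complex :: real_or_complex
proof
  show "\<exists>\<phi> :: complex \<Rightarrow> complex. (\<forall>x y. \<phi> (x + y) = \<phi> x + \<phi> y) \<and> (\<forall>r x. \<phi> (r *\<^sub>R x) = r *\<^sub>R \<phi> x) \<and>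
       (\<forall>x y. \<phi> (x * y) = \<phi> x * \<phi> y) \<and>
       (\<forall>x. norm (\<phi> x) = norm x) \<and> (range \<phi> = \<real> \<or> range \<phi> = UNIV)"
    by (rule exI[of _ "\<lambda>x. x"]) (auto)
qed

text \<open>
  The class \<^class>\<open>banach\<close> only provides real scalars. A Banach space over \<open>'k\<close> is a type of that class
  with a scalar multiplication by \<open>'k\<close>, or a closed \<open>'k\<close>-linear subspace of such a type. A sequence
  of Banach spaces is a sequence of closed subspaces of one type; this is no restriction, as every
  sequence of Banach spaces embeds isometrically in its \<open>\<ell>\<^sub>\<infinity>\<close>-sum.
\<close>

locale banach_space_over = vector_space scale
  for scale :: "'k::real_or_complex \<Rightarrow> 'a::banach \<Rightarrow> 'a" +
  assumes norm_scale: "norm (scale c x) = norm c * norm x"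
    and scale_of_real: "scale (of_real r) x = r *\<^sub>R x"

definition closed_subspace :: "('k::real_or_complex \<Rightarrow> 'a::banach \<Rightarrow> 'a) \<Rightarrow> 'a set \<Rightarrow> bool" where
  "closed_subspace s X \<longleftrightarrow> module.subspace s X \<and> closed X"

definition bounded_operator ::
  "('k::real_or_complex \<Rightarrow> 'a::banach \<Rightarrow> 'a) \<Rightarrow> ('k \<Rightarrow> 'b::banach \<Rightarrow> 'b) \<Rightarrow>
    'a set \<Rightarrow> 'b set \<Rightarrow> ('a \<Rightarrow> 'b) \<Rightarrow> bool" where
  "bounded_operator s t X Z T \<longleftrightarrow>
     T ` X \<subseteq> Z \<and>
     (\<forall>x\<in>X. \<forall>y\<in>X. T (x + y) = T x + T y) \<and>
     (\<forall>c. \<forall>x\<in>X. T (s c x) = t c (T x)) \<and>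
     (\<exists>B. \<forall>x\<in>X. norm (T x) \<le> B * norm x)"

text \<open>The library's \<^const>\<open>onorm\<close>, relative to a domain.\<close>

definition op_norm :: "'a::real_normed_vector set \<Rightarrow> ('a \<Rightarrow> 'b::real_normed_vector) \<Rightarrow> real" where
  "op_norm X T = (SUP x\<in>X. norm (T x) / norm x)"


section \<open>Spaces of bounded functions and \<open>c\<^sub>0\<close>-sums\<close>

instance bcontfun :: (metric_space, banach) banach ..

definition scale_bcontfun ::
  "('k::real_or_complex \<Rightarrow> 'a::banach \<Rightarrow> 'a) \<Rightarrow> 'k \<Rightarrow> ('i::topological_space \<Rightarrow>\<^sub>C 'a) \<Rightarrow> ('i \<Rightarrow>\<^sub>C 'a)" where
  "scale_bcontfun s c f = Bcontfun (\<lambda>i. s c (apply_bcontfun f i))"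

lemma apply_scale_bcontfun:
  assumes "banach_space_over s"
  shows "apply_bcontfun (scale_bcontfun s c f) i = s c (apply_bcontfun f i)"
proof -
  interpret banach_space_over s by fact
  have bl: "bounded_linear (s c)"
    by (rule bounded_linear_intro[where K = "norm c"])
       (auto simp: scale_right_distrib norm_scale mult.commute scale_left_commute simp flip: scale_of_real)
  have "continuous_on UNIV (\<lambda>i. s c (apply_bcontfun f i))"
    by (intro bounded_linear.continuous_on[OF bl]) auto
  moreover have "norm (s c (apply_bcontfun f i)) \<le> norm c * norm f" for i
    by (simp add: norm_scale mult_left_mono norm_bounded)
  ultimately have "(\<lambda>i. s c (apply_bcontfun f i)) \<in> bcontfun"
    by (rule bcontfun_normI)
  then show ?thesis
    unfolding scale_bcontfun_def by (simp add: Bcontfun_inverse)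
qed

lemma banach_space_over_bcontfun:
  assumes "banach_space_over (s :: 'k::real_or_complex \<Rightarrow> 'a::banach \<Rightarrow> 'a)"
  shows "banach_space_over
    (scale_bcontfun s :: 'k \<Rightarrow> ('i::metric_space \<Rightarrow>\<^sub>C 'a) \<Rightarrow> ('i \<Rightarrow>\<^sub>C 'a))"
proof -
  interpret banach_space_over s by fact
  note [simp] = apply_scale_bcontfun[OF assms]
  have le: "norm (scale_bcontfun s c f) \<le> norm c * norm f" for c and f :: "'i \<Rightarrow>\<^sub>C 'a"
    by (rule norm_bound) (simp add: norm_scale mult_left_mono norm_bounded)
  show ?thesis
  proof
    fix c and f :: "'i \<Rightarrow>\<^sub>C 'a"
    have "norm c * norm f \<le> norm (scale_bcontfun s c f)"
    proof (cases "c = 0")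
      case False
      have "scale_bcontfun s (inverse c) (scale_bcontfun s c f) = f"
        using False by (intro bcontfun_eqI) simp
      then have "norm f \<le> norm (scale_bcontfun s c f) / norm c"
        using le[of "inverse c" "scale_bcontfun s c f"]
        by (simp add: norm_inverse divide_inverse mult.commute)
      with False show ?thesis
        by (simp add: pos_le_divide_eq mult.commute)
    qed simp
    with le[of c f] show "norm (scale_bcontfun s c f) = norm c * norm f" by simp
  qed (auto intro!: bcontfun_eqI simp: scale_right_distrib scale_left_distrib scale_of_real)
qed

lemma banach_space_over_scalars: "banach_space_over ((*) :: 'k::real_or_complex \<Rightarrow> 'k \<Rightarrow> 'k)"
  by unfold_locales (auto simp: algebra_simps norm_mult scaleR_conv_of_real)

text \<open>
  All functions on a discrete space are continuous, so the following is the space of all bounded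
  families indexed by \<open>'i\<close>, with the supremum norm.
\<close>

type_synonym ('i, 'a) linf = "'i discrete \<Rightarrow>\<^sub>C 'a"

definition c0_sum :: "(nat \<Rightarrow> 'a::banach set) \<Rightarrow> (nat, 'a) linf set" where
  "c0_sum Z = {f. (\<forall>j. apply_bcontfun f (discrete j) \<in> Z j) \<and>
                  (\<lambda>j. norm (apply_bcontfun f (discrete j))) \<longlonglongrightarrow> 0}"

lemma closed_subspace_c0_sum:
  fixes s :: "'k::real_or_complex \<Rightarrow> 'a::banach \<Rightarrow> 'a"
  assumes s: "banach_space_over s" and Z: "\<And>j. closed_subspace s (Z j)"
  shows "closed_subspace (scale_bcontfun s) (c0_sum Z)"
proof -
  interpret banach_space_over s by fact
  interpret b: banach_space_over "scale_bcontfun s :: 'k \<Rightarrow> (nat, 'a) linf \<Rightarrow> _"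
    by (rule banach_space_over_bcontfun[OF s])
  note [simp] = apply_scale_bcontfun[OF s]
  have sub: "\<And>j. subspace (Z j)" and cl: "\<And>j. closed (Z j)"
    using Z by (auto simp: closed_subspace_def)
  have "b.subspace (c0_sum Z)"
    unfolding b.subspace_def
  proof (intro conjI ballI allI)
    show "0 \<in> c0_sum Z" using subspace_0[OF sub] by (simp add: c0_sum_def)
  next
    fix f g assume "f \<in> c0_sum Z" "g \<in> c0_sum Z"
    then show "f + g \<in> c0_sum Z"
      using subspace_add[OF sub]
      by (auto simp: c0_sum_def tendsto_norm_zero_iff intro: tendsto_add_zero)
  next
    fix c f assume "f \<in> c0_sum Z"
    then show "scale_bcontfun s c f \<in> c0_sum Z"
      using subspace_scale[OF sub]
      by (auto simp: c0_sum_def norm_scale intro: tendsto_mult_right_zero)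
  qed
  moreover have "closed (c0_sum Z)"
    unfolding closed_sequential_limits
  proof (intro allI impI, elim conjE)
    fix f l assume f: "\<forall>n. f n \<in> c0_sum Z" and lim: "f \<longlonglongrightarrow> l"
    have ul: "uniform_limit UNIV f l sequentially"
      by (rule tendsto_bcontfun_uniform_limit[OF lim])
    have "apply_bcontfun l (discrete j) \<in> Z j" for j
      by (rule Lim_in_closed_set[OF cl _ sequentially_bot tendsto_uniform_limitI[OF ul]])
         (use f in \<open>auto simp: c0_sum_def\<close>)
    moreover have "(\<lambda>j. apply_bcontfun l (discrete j)) \<longlonglongrightarrow> 0"
    proof (rule swap_uniform_limit'[where G = sequentially and F = sequentially])
      show "\<forall>\<^sub>F n in sequentially. (\<lambda>j. apply_bcontfun (f n) (discrete j)) \<longlonglongrightarrow> 0"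
        using f by (simp add: c0_sum_def tendsto_norm_zero_iff)
      show "uniform_limit UNIV (\<lambda>n j. apply_bcontfun (f n) (discrete j))
          (\<lambda>j. apply_bcontfun l (discrete j)) sequentially"
        using uniform_limit_compose'[OF ul, of discrete UNIV] by simp
    qed auto
    ultimately show "l \<in> c0_sum Z" by (simp add: c0_sum_def tendsto_norm_zero)
  qed
  ultimately show ?thesis by (simp add: closed_subspace_def)
qed


section \<open>Separability of quotients\<close>

definition quotient_space :: "'a::real_normed_vector set \<Rightarrow> 'a set \<Rightarrow> 'a set set" where
  "quotient_space Y X = (\<lambda>y. (+) y ` X) ` Y"

definition quotient_norm :: "'a::real_normed_vector set \<Rightarrow> real" where
  "quotient_norm A = infdist 0 A"

definition quotient_dist :: "'a::real_normed_vector set \<Rightarrow> 'a set \<Rightarrow> real" where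
  "quotient_dist A B = quotient_norm {a - b | a b. a \<in> A \<and> b \<in> B}"

definition separable_quotient :: "'a::real_normed_vector set \<Rightarrow> 'a set \<Rightarrow> bool" where
  "separable_quotient Y X \<longleftrightarrow>
     separable_space (Metric_space.mtopology (quotient_space Y X) quotient_dist)"

lemma Metric_space_quotient:
  fixes X :: "'a::banach set"
  assumes s: "banach_space_over s" and X: "closed_subspace s X"
  shows "Metric_space (quotient_space Y X) quotient_dist"
proof -
  interpret banach_space_over s by fact
  have cl: "closed X" and sub: "subspace X" using X by (auto simp: closed_subspace_def)
  have ne: "X \<noteq> {}" using subspace_0[OF sub] by auto
  have dist_eq: "quotient_dist ((+) y ` X) ((+) y' ` X) = infdist (y - y') X" for y y'
  proof -
    have "{a - b |a b. a \<in> (+) y ` X \<and> b \<in> (+) y' ` X} = (\<lambda>x. (y - y') - x) ` X"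
    proof (intro equalityI subsetI)
      fix v assume "v \<in> {a - b |a b. a \<in> (+) y ` X \<and> b \<in> (+) y' ` X}"
      then obtain x x' where "x \<in> X" "x' \<in> X" "v = (y + x) - (y' + x')" by auto
      then have "v = (y - y') - (x' - x)" "x' - x \<in> X" using subspace_diff[OF sub] by auto
      then show "v \<in> (\<lambda>x. (y - y') - x) ` X" by blast
    next
      fix v assume "v \<in> (\<lambda>x. (y - y') - x) ` X"
      then obtain x where "x \<in> X" "v = (y + 0) - (y' + x)" by (auto simp: algebra_simps)
      then show "v \<in> {a - b |a b. a \<in> (+) y ` X \<and> b \<in> (+) y' ` X}"
        using subspace_0[OF sub] by blast
    qed
    then show ?thesis
      using ne by (simp add: quotient_dist_def quotient_norm_def infdist_notempty image_image dist_norm norm_minus_commute)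
  qed
  have coset_eq: "(+) y ` X = (+) y' ` X \<longleftrightarrow> y - y' \<in> X" for y y'
  proof
    assume "(+) y ` X = (+) y' ` X"
    moreover have "y + 0 \<in> (+) y ` X" using subspace_0[OF sub] by blast
    ultimately have "y \<in> (+) y' ` X" by simp
    then show "y - y' \<in> X" by auto
  next
    assume d: "y - y' \<in> X"
    have "(+) y ` X \<subseteq> (+) y' ` X" if "y - y' \<in> X" for y y'
    proof
      fix v assume "v \<in> (+) y ` X"
      then obtain x where "x \<in> X" "v = y' + ((y - y') + x)" by auto
      then show "v \<in> (+) y' ` X" using subspace_add[OF sub that] by blast
    qed
    moreover have "y' - y \<in> X" using subspace_neg[OF sub d] by simp
    ultimately show "(+) y ` X = (+) y' ` X" using d by blast
  qed
  show ?thesis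
  proof
    fix A B :: "'a set"
    show "0 \<le> quotient_dist A B"
      by (simp add: quotient_dist_def quotient_norm_def infdist_nonneg)
    have "{a - b | a b. a \<in> A \<and> b \<in> B} = uminus ` {a - b | a b. a \<in> B \<and> b \<in> A}"
      by (auto simp: image_iff) (metis minus_diff_eq)+
    moreover have "infdist 0 (uminus ` S) = infdist 0 S" for S :: "'a set"
      by (simp add: infdist_def image_image)
    ultimately show "quotient_dist A B = quotient_dist B A"
      by (simp only: quotient_dist_def quotient_norm_def)
  next
    fix A B assume "A \<in> quotient_space Y X" "B \<in> quotient_space Y X"
    then obtain y y' where AB: "A = (+) y ` X" "B = (+) y' ` X"
      by (auto simp: quotient_space_def)
    show "quotient_dist A B = 0 \<longleftrightarrow> A = B"
      unfolding AB dist_eq coset_eq using in_closed_iff_infdist_zero[OF cl ne] by simp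
  next
    fix A B C
    assume "A \<in> quotient_space Y X" "B \<in> quotient_space Y X" "C \<in> quotient_space Y X"
    then obtain a b c where ABC: "A = (+) a ` X" "B = (+) b ` X" "C = (+) c ` X"
      by (auto simp: quotient_space_def)
    have "infdist (a - c) X \<le> infdist (a - b) X + infdist (b - c) X + e" if "e > 0" for e
    proof -
      have ex: "\<exists>x\<in>X. dist v x < infdist v X + e / 2" for v
      proof (rule ccontr)
        assume "\<not> ?thesis"
        then have "infdist v X + e / 2 \<le> infdist v X"
          unfolding infdist_notempty[OF ne] using ne by (intro cINF_greatest) (auto simp: not_less)
        with \<open>e > 0\<close> show False by simp
      qed
      obtain x where x: "x \<in> X" "dist (a - b) x < infdist (a - b) X + e / 2" using ex by blast
      obtain x' where x': "x' \<in> X" "dist (b - c) x' < infdist (b - c) X + e / 2" using ex by blast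
      have "infdist (a - c) X \<le> dist (a - c) (x + x')"
        using subspace_add[OF sub x(1) x'(1)] by (rule infdist_le)
      also have "\<dots> \<le> dist (a - b) x + dist (b - c) x'"
        using norm_triangle_ineq[of "a - b - x" "b - c - x'"] by (simp add: dist_norm algebra_simps)
      finally show ?thesis using x(2) x'(2) by simp
    qed
    then show "quotient_dist A C \<le> quotient_dist A B + quotient_dist B C"
      unfolding ABC dist_eq by (rule field_le_epsilon)
  qed
qed


section \<open>Injective Banach spaces\<close>

text \<open>
  A formula cannot quantify over all Banach spaces, only over those in a given type. Here \<open>X \<subset> Y\<close>
  range over the closed subspaces of \<open>('z, 'k) linf\<close>, where \<open>'z\<close> is the type in which
  \<open>Z\<close> lives. Theorem \<open>injective_extension\<close> below shows that this implies the extension property for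
  Banach spaces \<open>X \<subset> Y\<close> in any type whatsoever.
\<close>

definition injective :: "real \<Rightarrow> ('k::real_or_complex \<Rightarrow> 'z::banach \<Rightarrow> 'z) \<Rightarrow> 'z set \<Rightarrow> bool" where
  "injective lam s Z \<longleftrightarrow>
     (\<forall>(X :: ('z, 'k) linf set) Y T.
        closed_subspace (scale_bcontfun (*)) X \<and> closed_subspace (scale_bcontfun (*)) Y \<and> X \<subseteq> Y \<and>
        bounded_operator (scale_bcontfun (*)) s X Z T \<longrightarrow>
        (\<exists>T'. bounded_operator (scale_bcontfun (*)) s Y Z T' \<and> (\<forall>x\<in>X. T' x = T x) \<and>
              op_norm Y T' \<le> lam * op_norm X T))"

text \<open>The Hahn-Banach theorem, real and complex.\<close>

lemma hahn_banach_real: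
  fixes X :: "'a::real_normed_vector set" and f :: "'a \<Rightarrow> real"
  assumes X: "subspace X"
    and add: "\<And>x y. x \<in> X \<Longrightarrow> y \<in> X \<Longrightarrow> f (x + y) = f x + f y"
    and sc: "\<And>r x. x \<in> X \<Longrightarrow> f (r *\<^sub>R x) = r * f x"
    and le: "\<And>x. x \<in> X \<Longrightarrow> f x \<le> M * norm x" and M: "0 \<le> M"
  obtains F where "linear F" "\<And>x. x \<in> X \<Longrightarrow> F x = f x" "\<And>x. F x \<le> M * norm x"
proof -
  define G0 where "G0 = (\<lambda>x. (x, f x)) ` X"
  define \<A> where "\<A> = {G :: ('a \<times> real) set. subspace G \<and> G0 \<subseteq> G \<and> (\<forall>(x, t)\<in>G. t \<le> M * norm x)}"
  have "f 0 = 0" using sc[of 0 0] subspace_0[OF X] by simp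
  have "subspace G0"
    unfolding subspace_def
  proof (intro conjI ballI allI)
    show "0 \<in> G0" unfolding G0_def zero_prod_def
      using subspace_0[OF X] \<open>f 0 = 0\<close> by (intro image_eqI[of _ _ 0]) auto
  next
    fix u v assume "u \<in> G0" "v \<in> G0"
    then obtain x y where "x \<in> X" "y \<in> X" "u = (x, f x)" "v = (y, f y)" by (auto simp: G0_def)
    then show "u + v \<in> G0" unfolding G0_def
      using subspace_add[OF X] by (intro image_eqI[of _ _ "x + y"]) (auto simp: add)
  next
    fix r u assume "u \<in> G0"
    then obtain x where "x \<in> X" "u = (x, f x)" by (auto simp: G0_def)
    then show "r *\<^sub>R u \<in> G0" unfolding G0_def
      using subspace_scale[OF X] by (intro image_eqI[of _ _ "r *\<^sub>R x"]) (auto simp: sc)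
  qed
  then have "G0 \<in> \<A>" using le by (auto simp: \<A>_def G0_def)
  then have "\<exists>G\<in>\<A>. \<forall>H\<in>\<A>. G \<subseteq> H \<longrightarrow> H = G"
  proof (intro subset_Zorn_nonempty)
    fix \<C> assume ne: "\<C> \<noteq> {}" and chain: "subset.chain \<A> \<C>"
    then have sub: "\<C> \<subseteq> \<A>" and lin: "\<And>G H. G \<in> \<C> \<Longrightarrow> H \<in> \<C> \<Longrightarrow> G \<subseteq> H \<or> H \<subseteq> G"
      by (auto simp: subset.chain_def)
    have "subspace (\<Union>\<C>)"
      unfolding subspace_def
    proof (intro conjI ballI allI)
      show "0 \<in> \<Union>\<C>" using ne sub by (auto simp: \<A>_def subspace_def)
    next
      fix u v assume "u \<in> \<Union>\<C>" "v \<in> \<Union>\<C>"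
      then obtain G H where "G \<in> \<C>" "H \<in> \<C>" "u \<in> G" "v \<in> H" by auto
      with lin[of G H] obtain K where K: "K \<in> \<C>" "u \<in> K" "v \<in> K" by auto
      then have "u + v \<in> K" using sub by (auto simp: \<A>_def intro: subspace_add)
      then show "u + v \<in> \<Union>\<C>" using K by blast
    next
      fix c u assume "u \<in> \<Union>\<C>"
      then obtain K where K: "K \<in> \<C>" "u \<in> K" by auto
      then have "c *\<^sub>R u \<in> K" using sub by (auto simp: \<A>_def intro: subspace_scale)
      then show "c *\<^sub>R u \<in> \<Union>\<C>" using K by blast
    qed
    then show "\<Union>\<C> \<in> \<A>" using ne sub by (auto simp: \<A>_def)
  qed auto
  then obtain G where G: "G \<in> \<A>" and max: "\<And>H. H \<in> \<A> \<Longrightarrow> G \<subseteq> H \<Longrightarrow> H = G" by blast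
  have sG: "subspace G" and bd: "\<And>x t. (x, t) \<in> G \<Longrightarrow> t \<le> M * norm x" and G0: "G0 \<subseteq> G"
    using G by (auto simp: \<A>_def)
  have Gadd: "(x + y, t + u) \<in> G" if "(x, t) \<in> G" "(y, u) \<in> G" for x y t u
    using subspace_add[OF sG that] by simp
  have Gsc: "(r *\<^sub>R x, r * t) \<in> G" if "(x, t) \<in> G" for x t r
    using subspace_scale[OF sG that, of r] by simp
  have uniq: "t = u" if "(x, t) \<in> G" "(x, u) \<in> G" for x t u
  proof -
    have "t - u \<le> 0" "u - t \<le> 0"
      using bd[OF Gadd[OF that(1) Gsc[OF that(2), of "-1"]]]
            bd[OF Gadd[OF that(2) Gsc[OF that(1), of "-1"]]] by auto
    then show ?thesis by simp
  qed
  have total: "\<exists>t. (x0, t) \<in> G" for x0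
  proof (rule ccontr)
    assume no: "\<nexists>t. (x0, t) \<in> G"
    define L where "L = (\<lambda>(x, t). t - M * norm (x - x0)) ` G"
    define c where "c = Sup L"
    have G00: "(0, 0) \<in> G" using subspace_0[OF sG] by (simp add: zero_prod_def)
    have key: "t - M * norm (x - x0) \<le> M * norm (y + x0) - u" if "(x, t) \<in> G" "(y, u) \<in> G" for x t y u
    proof -
      have "t + u \<le> M * norm ((x - x0) + (y + x0))" using bd[OF Gadd[OF that]] by simp
      also have "\<dots> \<le> M * (norm (x - x0) + norm (y + x0))"
        by (rule mult_left_mono[OF norm_triangle_ineq M])
      finally show ?thesis by (simp add: algebra_simps)
    qed
    have "bdd_above L"
      using key[OF _ G00] unfolding L_def by (intro bdd_aboveI[of _ "M * norm (0 + x0) - 0"]) auto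
    then have c1: "t - M * norm (x - x0) \<le> c" if "(x, t) \<in> G" for x t
      unfolding c_def using that by (intro cSup_upper) (force simp: L_def)
    have c2: "c \<le> M * norm (y + x0) - u" if "(y, u) \<in> G" for y u
      unfolding c_def using G00 key[OF _ that] by (intro cSup_least) (auto simp: L_def)
    define H where "H = (\<lambda>((x, t), a). (x + a *\<^sub>R x0, t + a * c)) ` (G \<times> UNIV)"
    have Hbd: "t + a * c \<le> M * norm (x + a *\<^sub>R x0)" if xt: "(x, t) \<in> G" for x t a
    proof -
      consider "a = 0" | "a > 0" | "a < 0" by linarith
      then show ?thesis
      proof cases
        case 1 then show ?thesis using bd[OF xt] by simp
      next
        case 2
        have "c \<le> M * norm (inverse a *\<^sub>R x + x0) - inverse a * t" by (rule c2[OF Gsc[OF xt]])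
        then have "a * (inverse a * t + c) \<le> a * (M * norm (inverse a *\<^sub>R x + x0))"
          using 2 by (intro mult_left_mono) auto
        also have "\<dots> = M * norm (a *\<^sub>R (inverse a *\<^sub>R x + x0))" using 2 by simp
        finally show ?thesis using 2 by (simp add: distrib_left mult.assoc[symmetric] scaleR_right_distrib)
      next
        case 3
        have "inverse (-a) * t - M * norm (inverse (-a) *\<^sub>R x - x0) \<le> c" by (rule c1[OF Gsc[OF xt]])
        then have "(-a) * (inverse (-a) * t - c) \<le> (-a) * (M * norm (inverse (-a) *\<^sub>R x - x0))"
          using 3 by (intro mult_left_mono) auto
        also have "\<dots> = M * norm ((-a) *\<^sub>R (inverse (-a) *\<^sub>R x - x0))" using 3 by simp
        finally show ?thesis using 3 by (simp add: right_diff_distrib mult.assoc[symmetric] scaleR_right_diff_distrib)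
      qed
    qed
    have HI: "(x + a *\<^sub>R x0, t + a * c) \<in> H" if "(x, t) \<in> G" for x t a
      unfolding H_def using that by (intro image_eqI[of _ _ "((x, t), a)"]) auto
    have HE: "\<exists>x t a. (x, t) \<in> G \<and> u = (x + a *\<^sub>R x0, t + a * c)" if "u \<in> H" for u
      using that by (auto simp: H_def)
    have "subspace H"
      unfolding subspace_def
    proof (intro conjI ballI allI)
      show "0 \<in> H" using HI[OF G00, of 0] by (simp add: zero_prod_def)
    next
      fix u v assume "u \<in> H" "v \<in> H"
      then obtain x t a y r b where *: "(x, t) \<in> G" "u = (x + a *\<^sub>R x0, t + a * c)"
        "(y, r) \<in> G" "v = (y + b *\<^sub>R x0, r + b * c)" using HE by meson
      then show "u + v \<in> H"
        using HI[OF Gadd[OF *(1,3)], of "a + b"] by (simp add: algebra_simps)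
    next
      fix r u assume "u \<in> H"
      then obtain x t a where *: "(x, t) \<in> G" "u = (x + a *\<^sub>R x0, t + a * c)" using HE by meson
      then show "r *\<^sub>R u \<in> H"
        using HI[OF Gsc[OF *(1)], of r "r * a"] by (simp add: algebra_simps)
    qed
    moreover have GH: "G \<subseteq> H"
    proof
      fix u assume "u \<in> G"
      then show "u \<in> H" using HI[of "fst u" "snd u" 0] by simp
    qed
    ultimately have "H \<in> \<A>" using G0 Hbd by (auto simp: \<A>_def H_def)
    then have "H = G" using max GH by blast
    moreover have "(x0, c) \<in> H" using HI[OF G00, of 1] by simp
    ultimately show False using no by blast
  qed
  define F where "F x = (THE t. (x, t) \<in> G)" for x
  have F: "(x, F x) \<in> G" for x
    unfolding F_def using total[of x] uniq by (metis theI)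
  show thesis
  proof
    show "linear F" by (intro linearI uniq[OF F]) (auto intro: Gadd Gsc F)
    show "F x = f x" if "x \<in> X" for x using that G0 by (intro uniq[OF F]) (auto simp: G0_def)
    show "F x \<le> M * norm x" for x by (rule bd[OF F])
  qed
qed

lemma hahn_banach:
  fixes s :: "'k::real_or_complex \<Rightarrow> 'a::banach \<Rightarrow> 'a"
  assumes s: "banach_space_over s" and X: "module.subspace s X"
    and add: "\<And>x y. x \<in> X \<Longrightarrow> y \<in> X \<Longrightarrow> f (x + y) = f x + f y"
    and sc: "\<And>c x. x \<in> X \<Longrightarrow> f (s c x) = c * f x"
    and le: "\<And>x. x \<in> X \<Longrightarrow> norm (f x) \<le> M * norm x" and M: "0 \<le> M"
  obtains g :: "'a \<Rightarrow> 'k" where "\<And>x y. g (x + y) = g x + g y" "\<And>c x. g (s c x) = c * g x"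
    "\<And>x. x \<in> X \<Longrightarrow> g x = f x" "\<And>x. norm (g x) \<le> M * norm x"
proof -
  interpret banach_space_over s by fact
  obtain \<phi> :: "'k \<Rightarrow> complex" where \<phi>: "\<And>x y. \<phi> (x + y) = \<phi> x + \<phi> y"
    "\<And>r x. \<phi> (r *\<^sub>R x) = r *\<^sub>R \<phi> x" "\<And>x y. \<phi> (x * y) = \<phi> x * \<phi> y"
    "\<And>x. norm (\<phi> x) = norm x" and rng: "range \<phi> = \<real> \<or> range \<phi> = UNIV"
    using ex_iso_real_or_complex by blast
  have lin\<phi>: "linear \<phi>" using \<phi> by (intro linearI)
  have inj: "x = y" if "\<phi> x = \<phi> y" for x y
    using \<phi>(4)[of "x - y"] that linear_diff[OF lin\<phi>] by simp
  have \<phi>1: "\<phi> 1 = 1" using \<phi>(3)[of 1 1] \<phi>(4)[of 1] by auto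
  have \<phi>r: "\<phi> (of_real r) = of_real r" for r
    using \<phi>(2)[of r 1] \<phi>1 by (simp add: of_real_def)
  have sR: "real_vector.subspace X"
    using X by (auto simp: subspace_def real_vector.subspace_def simp flip: scale_of_real)
  obtain F where F: "linear F" "\<And>x. x \<in> X \<Longrightarrow> F x = Re (\<phi> (f x))" "\<And>x. F x \<le> M * norm x"
  proof (rule hahn_banach_real[OF sR _ _ _ M, of "\<lambda>x. Re (\<phi> (f x))"])
    fix r x assume "x \<in> X"
    then show "Re (\<phi> (f (r *\<^sub>R x))) = r * Re (\<phi> (f x))"
      using sc[of x "of_real r"] by (simp add: scale_of_real \<phi> \<phi>r)
  next
    fix x assume "x \<in> X"
    have "Re (\<phi> (f x)) \<le> norm (f x)" using complex_Re_le_cmod[of "\<phi> (f x)"] by (simp add: \<phi>)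
    then show "Re (\<phi> (f x)) \<le> M * norm x" using le[OF \<open>x \<in> X\<close>] by linarith
  qed (auto simp: add \<phi>)
  have Fr: "F (s (of_real r) x) = r * F x" for r x
    using linear_scale[OF F(1)] by (simp add: scale_of_real)
  have "\<exists>g. (\<forall>x y. g (x + y) = g x + g y) \<and> (\<forall>c x. g (s c x) = c * g x) \<and>
        (\<forall>x. Re (\<phi> (g x)) = F x)"
    using rng
  proof
    assume R: "range \<phi> = \<real>"
    have c: "\<exists>r. c = of_real r" for c :: 'k
    proof -
      obtain r where "\<phi> c = of_real r" using R by (metis Reals_cases rangeI)
      then show ?thesis using inj[of c "of_real r"] \<phi>r by auto
    qed
    have "of_real (F (s c x)) = c * of_real (F x)" for c x
    proof -
      obtain r where "c = of_real r" using c by blast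
      then show ?thesis by (simp add: Fr)
    qed
    then show ?thesis
      by (intro exI[of _ "\<lambda>x. of_real (F x)"]) (simp add: \<phi>r linear_add[OF F(1)])
  next
    assume C: "range \<phi> = UNIV"
    then obtain \<iota> where \<iota>: "\<phi> \<iota> = \<i>" by (metis UNIV_I imageE)
    have \<iota>2: "\<iota> * \<iota> = -1" by (rule inj) (simp add: \<phi> \<iota> linear_neg[OF lin\<phi>] \<phi>1)
    define g where "g x = of_real (F x) - \<iota> * of_real (F (s \<iota> x))" for x
    have c: "\<exists>a b. c = of_real a + of_real b * \<iota>" for c :: 'k
      by (intro exI[of _ "Re (\<phi> c)"] exI[of _ "Im (\<phi> c)"] inj)
         (simp add: \<phi> \<phi>r \<iota> complex_eq mult.commute)
    have gadd: "g (x + y) = g x + g y" for x y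
      by (simp add: g_def linear_add[OF F(1)] scale_right_distrib algebra_simps)
    have gr: "g (s (of_real r) x) = of_real r * g x" for r x
    proof -
      have "s \<iota> (s (of_real r) x) = s (of_real r) (s \<iota> x)" by (rule scale_left_commute)
      then show ?thesis by (simp only: g_def Fr of_real_mult) (simp add: algebra_simps)
    qed
    have gi: "g (s \<iota> x) = \<iota> * g x" for x
    proof -
      have "s \<iota> (s \<iota> x) = - x" by (simp add: \<iota>2)
      then have "g (s \<iota> x) = of_real (F (s \<iota> x)) + \<iota> * of_real (F x)"
        by (simp add: g_def linear_neg[OF F(1)])
      moreover have "\<iota> * (\<iota> * w) = - w" for w
        using \<iota>2 by (simp flip: mult.assoc)
      ultimately show ?thesis by (simp only: g_def right_diff_distrib) simp
    qed
    have "g (s c x) = c * g x" for c x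
    proof -
      obtain a b where ab: "c = of_real a + of_real b * \<iota>" using c by blast
      have "g (s c x) = g (s (of_real a) x + s (of_real b) (s \<iota> x))"
        by (simp add: ab scale_left_distrib)
      also have "\<dots> = of_real a * g x + of_real b * (\<iota> * g x)"
        by (simp only: gadd gr gi)
      finally show ?thesis by (simp add: ab algebra_simps)
    qed
    moreover have "Re (\<phi> (g x)) = F x" for x
      by (simp add: g_def linear_diff[OF lin\<phi>] \<phi> \<phi>r \<iota>)
    ultimately show ?thesis using gadd by blast
  qed
  then obtain g where g: "\<And>x y. g (x + y) = g x + g y" "\<And>c x. g (s c x) = c * g x"
    "\<And>x. Re (\<phi> (g x)) = F x" by blast
  show thesis
  proof
    show "g x = f x" if x: "x \<in> X" for x
    proof -
      have eq: "Re (\<phi> (c * (g x - f x))) = 0" for c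
      proof -
        have "s c x \<in> X" using X x by (simp add: subspace_def)
        then have "Re (\<phi> (c * g x)) = Re (\<phi> (c * f x))"
          using g(3)[of "s c x"] F(2)[of "s c x"] by (simp add: g(2) sc x)
        then show ?thesis by (simp add: right_diff_distrib linear_diff[OF lin\<phi>])
      qed
      show ?thesis
      proof (rule ccontr)
        assume "g x \<noteq> f x"
        then have "Re (\<phi> 1) = 0" using eq[of "inverse (g x - f x)"] by simp
        then show False by (simp add: \<phi>1)
      qed
    qed
    show "norm (g x) \<le> M * norm x" for x
    proof (cases "g x = 0")
      case True then show ?thesis using M by simp
    next
      case False
      define c where "c = of_real (norm (g x)) * inverse (g x)"
      have c1: "norm c = 1" using False by (simp add: c_def norm_mult norm_inverse)
      have "c * g x = of_real (norm (g x))" using False by (simp add: c_def mult.assoc)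
      then have "norm (g x) = Re (\<phi> (c * g x))" by (simp add: \<phi>r)
      also have "\<dots> \<le> M * norm (s c x)" using F(3)[of "s c x"] g(3)[of "s c x"] by (simp add: g(2))
      finally show ?thesis by (simp add: norm_scale c1)
    qed
  qed (use g in auto)
qed

lemma op_norm_bound:
  assumes "bounded_operator s t X Z T" "x \<in> X"
  shows "norm (T x) \<le> op_norm X T * norm x"
proof (cases "x = 0")
  case False
  obtain B where B: "\<And>x. x \<in> X \<Longrightarrow> norm (T x) \<le> B * norm x"
    using assms(1) unfolding bounded_operator_def by blast
  have "norm (T x) / norm x \<le> \<bar>B\<bar>" if "x \<in> X" for x
  proof (cases "x = 0")
    case False
    have "norm (T x) \<le> \<bar>B\<bar> * norm x"
      using B[OF that] by (rule order_trans) (intro mult_right_mono; simp)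
    with False show ?thesis by (simp add: pos_divide_le_eq)
  qed simp
  then have "bdd_above ((\<lambda>x. norm (T x) / norm x) ` X)" by (auto simp: bdd_above_def)
  then have "norm (T x) / norm x \<le> op_norm X T"
    unfolding op_norm_def by (intro cSUP_upper assms(2))
  with False show ?thesis by (simp add: pos_divide_le_eq)
next
  case True
  then show ?thesis using assms by (auto simp: bounded_operator_def)
qed

lemma op_norm_least:
  assumes "X \<noteq> {}" "0 \<le> B" "\<And>x. x \<in> X \<Longrightarrow> norm (T x) \<le> B * norm x"
  shows "op_norm X T \<le> B"
  unfolding op_norm_def
proof (rule cSUP_least)
  fix x assume "x \<in> X"
  with assms show "norm (T x) / norm x \<le> B"
    by (cases "x = 0") (auto simp: pos_divide_le_eq)
qed fact

lemma op_norm_nonneg: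
  assumes "bounded_operator s t X Z T" "0 \<in> X"
  shows "0 \<le> op_norm X T"
proof (cases "\<exists>x\<in>X. x \<noteq> 0")
  case True
  then obtain x where x: "x \<in> X" "x \<noteq> 0" by blast
  have "0 \<le> op_norm X T * norm x" by (rule order_trans[OF norm_ge_zero op_norm_bound[OF assms(1) x(1)]])
  then show ?thesis using x by (simp add: zero_le_mult_iff)
next
  case False
  with assms(2) have "X = {0}" by auto
  then show ?thesis by (simp add: op_norm_def)
qed

theorem injective_extension:
  fixes sz :: "'k::real_or_complex \<Rightarrow> 'z::banach \<Rightarrow> 'z"
    and sy :: "'k \<Rightarrow> 'y::banach \<Rightarrow> 'y"
  assumes sz: "banach_space_over sz" and Z: "closed_subspace sz Z" and inj: "injective lam sz Z"
    and lam: "0 \<le> lam"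
    and sy: "banach_space_over sy" and X: "closed_subspace sy X" and Y: "closed_subspace sy Y"
    and XY: "X \<subseteq> Y" and T: "bounded_operator sy sz X Z T"
  shows "\<exists>T'. bounded_operator sy sz Y Z T' \<and> (\<forall>x\<in>X. T' x = T x) \<and>
              op_norm Y T' \<le> lam * op_norm X T"
proof -
  interpret z: banach_space_over sz by fact
  interpret y: banach_space_over sy by fact
  let ?u = "scale_bcontfun (*) :: 'k \<Rightarrow> ('z, 'k) linf \<Rightarrow> ('z, 'k) linf"
  have u: "banach_space_over ?u"
    by (rule banach_space_over_bcontfun[OF banach_space_over_scalars])
  interpret u: banach_space_over ?u by (rule u)
  have app_u: "apply_bcontfun (?u c v) i = c * apply_bcontfun v i" for c v i
    by (rule apply_scale_bcontfun[OF banach_space_over_scalars])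
  have subX: "y.subspace X" and subY: "y.subspace Y" and subZ: "z.subspace Z" and clZ: "closed Z"
    using X Y Z by (auto simp: closed_subspace_def)
  have Tadd: "\<And>x y. x \<in> X \<Longrightarrow> y \<in> X \<Longrightarrow> T (x + y) = T x + T y"
    and Tsc: "\<And>c x. x \<in> X \<Longrightarrow> T (sy c x) = sz c (T x)" and TZ: "\<And>x. x \<in> X \<Longrightarrow> T x \<in> Z"
    using T by (auto simp: bounded_operator_def)
  define M where "M = op_norm X T"
  have M: "0 \<le> M" unfolding M_def by (rule op_norm_nonneg[OF T y.subspace_0[OF subX]])

  have "\<exists>g. (\<forall>x y. g (x + y) = g x + g y) \<and> (\<forall>c x. g (sz c x) = c * g x) \<and>
      (\<forall>x. norm (g x) \<le> norm x) \<and> norm (g w) = norm w" for w :: 'z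
  proof (cases "w = 0")
    case True
    then show ?thesis by (intro exI[of _ "\<lambda>_. 0"]) simp
  next
    case False
    define L where "L = range (\<lambda>c. sz c w)"
    define f where "f v = (THE c. v = sz c w) * of_real (norm w)" for v
    have f: "f (sz c w) = c * of_real (norm w)" for c
    proof -
      have "(THE d. sz c w = sz d w) = c" using False by (intro the_equality) auto
      then show ?thesis by (simp add: f_def)
    qed
    have "z.subspace L"
      unfolding z.subspace_def L_def
      by (auto simp: image_iff intro: exI[of _ 0] simp flip: z.scale_left_distrib z.scale_scale)
        (metis z.scale_scale)
    then obtain g :: "'z \<Rightarrow> 'k" where g: "\<And>x y. g (x + y) = g x + g y"
      "\<And>c x. g (sz c x) = c * g x" "\<And>x. x \<in> L \<Longrightarrow> g x = f x" "\<And>x. norm (g x) \<le> 1 * norm x"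
    proof (rule hahn_banach[OF sz, of L f 1])
      show "f (x + y) = f x + f y" if "x \<in> L" "y \<in> L" for x y
        using that by (auto simp: L_def f algebra_simps simp flip: z.scale_left_distrib)
      show "f (sz c x) = c * f x" if "x \<in> L" for c x
        using that by (auto simp: L_def f)
      show "norm (f x) \<le> 1 * norm x" if "x \<in> L" for x
        using that by (auto simp: L_def f norm_mult z.norm_scale)
    qed auto
    have "w \<in> L" unfolding L_def by (rule image_eqI[of _ _ 1]) simp_all
    then have "g w = of_real (norm w)" using g(3)[of w] f[of 1] by simp
    then show ?thesis using g by (intro exI[of _ g]) auto
  qed
  then obtain \<psi> where \<psi>: "\<And>w x y. \<psi> w (x + y) = \<psi> w x + \<psi> w y" "\<And>w c x. \<psi> w (sz c x) = c * \<psi> w x"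
    "\<And>w x. norm (\<psi> w x) \<le> norm x" "\<And>w. norm (\<psi> w w) = norm w"
    by metis

  have ubc: "(\<lambda>i. h (of_discrete i)) \<in> bcontfun" if "\<And>w. norm (h w) \<le> b"
    for h :: "'z \<Rightarrow> 'k" and b
    using that by (intro bcontfun_normI[of _ b]) (auto simp: continuous_on_open_vimage open_discrete)
  define J where "J x = (Bcontfun (\<lambda>i. \<psi> (of_discrete i) x) :: 'z discrete \<Rightarrow>\<^sub>C 'k)" for x
  have J: "apply_bcontfun (J x) i = \<psi> (of_discrete i) x" for x i
    unfolding J_def using ubc[of "\<lambda>w. \<psi> w x" "norm x"] \<psi>(3) by (simp add: Bcontfun_inverse)
  have Jadd: "J (x + y) = J x + J y" for x y by (rule bcontfun_eqI) (simp add: J \<psi>)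
  have Jsc: "J (sz c x) = ?u c (J x)" for c x by (rule bcontfun_eqI) (simp add: J \<psi> app_u)
  have Jnorm: "norm (J x) = norm x" for x
  proof (rule antisym)
    show "norm (J x) \<le> norm x" by (rule norm_bound) (simp add: J \<psi>)
    have "norm (apply_bcontfun (J x) (discrete x)) = norm x" by (simp add: J \<psi> discrete_inverse)
    then show "norm x \<le> norm (J x)" by (metis norm_bounded)
  qed
  have J_lin: "linear J"
  proof (rule linearI)
    show "J (r *\<^sub>R x) = r *\<^sub>R J x" for r x
      using Jsc[of "of_real r" x] by (simp add: z.scale_of_real u.scale_of_real)
  qed (rule Jadd)
  have Jinj: "x = y" if "J x = J y" for x y
    using Jnorm[of "x - y"] that by (simp add: linear_diff[OF J_lin])
  define K where "K = inv J"
  have KJ: "K (J x) = x" for x unfolding K_def using Jinj by (simp add: injI)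
  have clJ: "closed_subspace ?u (J ` Z)"
    unfolding closed_subspace_def
  proof
    show "u.subspace (J ` Z)"
      unfolding u.subspace_def
    proof (intro conjI ballI allI)
      show "0 \<in> J ` Z" using linear_0[OF J_lin] z.subspace_0[OF subZ] by (metis imageI)
    qed (use z.subspace_add[OF subZ] z.subspace_scale[OF subZ] in
          \<open>auto simp flip: Jadd Jsc\<close>)
    have "bounded_linear J"
      by (intro bounded_linear_intro[where K = 1]) (auto simp: Jadd linear_scale[OF J_lin] Jnorm)
    moreover have real_Z: "real_vector.subspace Z"
      using subZ by (auto simp: z.subspace_def real_vector.subspace_def simp flip: z.scale_of_real)
    ultimately have "complete (J ` Z)"
      using clZ real_Z by (intro complete_isometric_image[where e = 1 and s = Z])
        (auto simp: Jnorm complete_eq_closed)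
    then show "closed (J ` Z)" by (rule complete_imp_closed)
  qed
  have clU: "closed_subspace ?u UNIV"
    by (simp add: closed_subspace_def u.subspace_UNIV)
  have Kop: "bounded_operator ?u sz (J ` Z) Z K"
    unfolding bounded_operator_def
    by (auto simp: KJ simp flip: Jadd Jsc intro!: exI[of _ 1]) (simp add: Jnorm)
  have Knorm: "op_norm (J ` Z) K \<le> 1"
    using z.subspace_0[OF subZ] by (intro op_norm_least) (auto simp: KJ Jnorm)
  obtain P where P: "bounded_operator ?u sz UNIV Z P" "\<And>v. v \<in> J ` Z \<Longrightarrow> P v = K v"
    "op_norm UNIV P \<le> lam * op_norm (J ` Z) K"
    using inj clJ clU Kop unfolding injective_def by (metis subset_UNIV)
  have Padd: "\<And>v w. P (v + w) = P v + P w" and Psc: "\<And>c v. P (?u c v) = sz c (P v)"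
    and PZ: "\<And>v. P v \<in> Z"
    using P(1) by (auto simp: bounded_operator_def)
  have Pnorm: "norm (P v) \<le> lam * norm v" for v
  proof -
    have "norm (P v) \<le> op_norm UNIV P * norm v" using op_norm_bound[OF P(1)] by simp
    also have "op_norm UNIV P \<le> lam" using P(3) mult_left_mono[OF Knorm lam] by simp
    finally show ?thesis by (simp add: mult_right_mono)
  qed

  have "\<exists>g. (\<forall>x y. g (x + y) = g x + g y) \<and> (\<forall>c x. g (sy c x) = c * g x) \<and>
      (\<forall>x\<in>X. g x = \<psi> w (T x)) \<and> (\<forall>x. norm (g x) \<le> M * norm x)" for w
  proof (rule hahn_banach[OF sy subX _ _ _ M, of "\<lambda>x. \<psi> w (T x)"], goal_cases)
    case (4 g)
    then show ?case by blast
  next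
    fix x assume that: "x \<in> X"
    show "norm (\<psi> w (T x)) \<le> M * norm x"
      using \<psi>(3)[of w "T x"] op_norm_bound[OF T that] unfolding M_def by linarith
  qed (auto simp: Tadd Tsc \<psi>)
  then obtain G where G: "\<And>w x y. G w (x + y) = G w x + G w y" "\<And>w c x. G w (sy c x) = c * G w x"
    "\<And>w x. x \<in> X \<Longrightarrow> G w x = \<psi> w (T x)" "\<And>w x. norm (G w x) \<le> M * norm x"
    by metis
  define R where "R x = (Bcontfun (\<lambda>i. G (of_discrete i) x) :: 'z discrete \<Rightarrow>\<^sub>C 'k)" for x
  have R: "apply_bcontfun (R x) i = G (of_discrete i) x" for x i
    unfolding R_def using ubc[of "\<lambda>w. G w x" "M * norm x"] G(4) by (simp add: Bcontfun_inverse)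
  have Radd: "R (x + y) = R x + R y" for x y by (rule bcontfun_eqI) (simp add: R G)
  have Rsc: "R (sy c x) = ?u c (R x)" for c x by (rule bcontfun_eqI) (simp add: R G app_u)
  have Rnorm: "norm (R x) \<le> M * norm x" for x by (rule norm_bound) (simp add: R G)
  have RX: "R x = J (T x)" if "x \<in> X" for x by (rule bcontfun_eqI) (simp add: R J G that)
  have le: "norm (P (R x)) \<le> (lam * M) * norm x" for x
    using Pnorm[of "R x"] mult_left_mono[OF Rnorm[of x] lam] by simp
  show ?thesis
  proof (intro exI[of _ "\<lambda>x. P (R x)"] conjI ballI)
    show "bounded_operator sy sz Y Z (\<lambda>x. P (R x))"
      unfolding bounded_operator_def using le by (auto simp: Radd Rsc Padd Psc PZ)
    show "P (R x) = T x" if "x \<in> X" for x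
      using that by (simp add: RX P(2) TZ KJ)
    show "op_norm Y (\<lambda>x. P (R x)) \<le> lam * op_norm X T"
      using y.subspace_0[OF subY] lam M le
      by (intro op_norm_least) (auto simp: M_def)
  qed
qed

end

theory Submission
  imports Defs
begin

text \<open>
  Write \<open>T = (T\<^sub>j)\<close> and \<open>M = \<parallel>T\<parallel>\<close>. Each \<open>T\<^sub>j\<close> extends to \<open>Y\<close> with norm at most \<open>M\<close>, but the values of
  these extensions at a point outside \<open>X\<close> need not tend to \<open>0\<close>. The remedy is to prescribe, before
  invoking injectivity, that the extension of \<open>T\<^sub>j\<close> vanishes on a finite-dimensional space that grows
  slowly with \<open>j\<close>; the price is the factor \<open>2\<close>.

  Let \<open>E\<close> be finite-dimensional with \<open>X \<inter> E = 0\<close>, and extend \<open>T\<^sub>j\<close> to \<open>X + E\<close> by \<open>x + e \<mapsto> T\<^sub>j x\<close>. If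
  \<open>\<parallel>x + e\<parallel> \<le> 1\<close>, then \<open>e\<close> lies in a fixed compact set (lemma \<open>compact_representatives\<close>), hence near one of
  finitely many vectors \<open>k\<close>. Fix for each \<open>k\<close> a vector \<open>p\<^sub>k \<in> X\<close> that almost minimises
  \<open>\<parallel>p\<^sub>k + k\<parallel>\<close>. For the \<open>k\<close> near \<open>e\<close> this minimum is about \<open>1\<close> at most, so
  \<open>\<parallel>x - p\<^sub>k\<parallel> \<le> \<parallel>x + k\<parallel> + \<parallel>p\<^sub>k + k\<parallel>\<close> is at most about \<open>2\<close>, and therefore \<open>\<parallel>T\<^sub>j x\<parallel>\<close> is at most about
  \<open>2M + \<parallel>T\<^sub>j p\<^sub>k\<parallel>\<close>. As \<open>T\<^sub>j p\<^sub>k\<close> tends to \<open>0\<close> for each of the finitely many \<open>k\<close>, the extension to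
  \<open>X + E\<close> has norm at most \<open>(2 + \<delta>) M\<close> for all large \<open>j\<close> (lemma \<open>eventually_norm_le_on_finite_extension\<close>).

  Since \<open>Y/X\<close> is separable, there are increasing spaces \<open>E\<^sub>n\<close> of this kind, all in the kernel of one
  algebraic projection \<open>Q\<close> onto \<open>X\<close>, such that the union of the spaces \<open>X + E\<^sub>n\<close> is dense in \<open>Y\<close>. Let
  \<open>N\<^sub>j\<close> tend to infinity so slowly that the bound holds for \<open>T\<^sub>j\<close> and \<open>E\<^sub>n\<close> with \<open>n = N\<^sub>j\<close>, and extend
  \<open>T\<^sub>j \<circ> Q\<close> from \<open>X + E\<^sub>n\<close> to \<open>R\<^sub>j\<close> on \<open>Y\<close> by the injectivity of \<open>Z\<^sub>j\<close>. On each \<open>X + E\<^sub>n\<close> the values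
  \<open>R\<^sub>j w\<close> eventually equal \<open>T\<^sub>j (Q w)\<close>, which tends to \<open>0\<close>; by density and uniform boundedness
  \<open>R\<^sub>j y\<close> tends to \<open>0\<close> for every \<open>y \<in> Y\<close>, so that \<open>(R\<^sub>j)\<close> maps into the \<open>c\<^sub>0\<close>-sum.
\<close>

section \<open>Finite-dimensional extensions of a closed subspace\<close>

text \<open>
  Compactness is carried over from \<open>\<complex>\<close> along the isometry that the class of scalars
  provides, whose range is closed.
\<close>

lemma compact_cball_scalars:
  fixes r :: real
  shows "compact (cball (0 :: 'k::real_or_complex) r)"
proof -
  obtain \<phi> :: "'k \<Rightarrow> complex" where \<phi>: "\<And>x y. \<phi> (x + y) = \<phi> x + \<phi> y"
    "\<And>r x. \<phi> (r *\<^sub>R x) = r *\<^sub>R \<phi> x" "\<And>x. norm (\<phi> x) = norm x"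
    and rng: "range \<phi> = \<real> \<or> range \<phi> = UNIV"
    using ex_iso_real_or_complex by blast
  interpret \<phi>: linear \<phi> using \<phi> by (intro linearI)
  have dist: "dist (\<phi> x) (\<phi> y) = dist x y" for x y
    by (simp add: dist_norm \<phi> flip: \<phi>.diff)
  have inv: "inv \<phi> (\<phi> x) = x" for x
  proof (rule inv_f_f)
    show "inj \<phi>" by (rule injI) (metis dist dist_eq_0_iff)
  qed
  have "\<phi> ` cball 0 r = cball 0 r \<inter> range \<phi>" by (auto simp: \<phi>)
  moreover have "closed (range \<phi>)" using rng closed_complex_Reals by auto
  ultimately have "compact (\<phi> ` cball 0 r)" by (simp add: compact_Int_closed)
  moreover have "continuous_on (\<phi> ` cball 0 r) (inv \<phi>)"
    unfolding continuous_on_iff by (auto simp: inv dist)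
  ultimately have "compact (inv \<phi> ` \<phi> ` cball 0 r)" by (rule compact_continuous_image[rotated])
  then show ?thesis by (simp add: image_image inv)
qed

context banach_space_over
begin

lemma scaleR_mem: "subspace V \<Longrightarrow> v \<in> V \<Longrightarrow> r *\<^sub>R v \<in> V"
  using subspace_scale[of V v "of_real r"] by (simp add: scale_of_real)

text \<open>
  A convergent sequence in \<open>span (X \<union> F)\<close> is bounded, so for a suitable \<open>R\<close> it lies in \<open>X + R C\<close>, which is
  closed as the sum of a closed and a compact set.
\<close>

lemma closed_of_compact_representatives:
  assumes X: "closed_subspace scale X" and C: "compact C" "C \<subseteq> span F"
    and rep: "\<And>v. v \<in> span (X \<union> F) \<Longrightarrow> norm v \<le> 1 \<Longrightarrow> \<exists>e\<in>C. v - e \<in> X"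
  shows "closed (span (X \<union> F))"
  unfolding closed_sequential_limits
proof (intro allI impI, elim conjE)
  fix f l assume f: "\<forall>n. f n \<in> span (X \<union> F)" and lim: "f \<longlonglongrightarrow> l"
  have subX: "subspace X" and clX: "closed X" using X by (auto simp: closed_subspace_def)
  obtain R where R: "R > 0" "\<And>n. norm (f n) \<le> R"
    using convergent_imp_Bseq[of f] lim by (auto simp: convergent_def Bseq_def)
  let ?S = "\<Union>x\<in>X. \<Union>e\<in>(\<lambda>e. R *\<^sub>R e) ` C. {x + e}"
  have "closed ?S"
    by (intro closed_compact_sums clX compact_scaling C)
  moreover have "f n \<in> ?S" for n
  proof -
    have "inverse R *\<^sub>R f n \<in> span (X \<union> F)" using f by (intro scaleR_mem) auto
    moreover have "norm (inverse R *\<^sub>R f n) \<le> 1" using R(1) R(2)[of n] by (simp add: field_simps)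
    ultimately obtain e where e: "e \<in> C" "inverse R *\<^sub>R f n - e \<in> X" using rep by blast
    have "f n = R *\<^sub>R (inverse R *\<^sub>R f n - e) + R *\<^sub>R e"
      using R(1) by (simp add: scaleR_right_diff_distrib)
    moreover have "R *\<^sub>R (inverse R *\<^sub>R f n - e) \<in> X" by (rule scaleR_mem[OF subX e(2)])
    ultimately show ?thesis using e(1) by blast
  qed
  ultimately have "l \<in> ?S" using lim closed_sequentially by blast
  then obtain x e where "x \<in> X" "e \<in> C" and l: "l = x + R *\<^sub>R e" by auto
  moreover have "e \<in> span (X \<union> F)" using \<open>e \<in> C\<close> C(2) span_mono[of F "X \<union> F"] by blast
  ultimately show "l \<in> span (X \<union> F)"
    unfolding l by (intro span_add scaleR_mem) (auto intro: span_base)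
qed

text \<open>
  This is the compactness of the unit ball of \<open>(X + span F)/X\<close>, lifted to \<open>span F\<close>. Adding
  a vector \<open>y\<close> at positive distance \<open>d\<close> from the previous space \<open>V\<close>, the coefficient of \<open>y\<close> in a vector of
  norm at most \<open>1\<close> is at most \<open>1/d\<close> in absolute value, and its component in \<open>V\<close> is bounded by
  \<open>1 + \<parallel>y\<parallel>/d\<close>. That \<open>d > 0\<close> needs \<open>V\<close> to be closed, which the induction hypothesis gives.
\<close>

lemma compact_representatives:
  assumes X: "closed_subspace scale X" and F: "finite F"
  shows "\<exists>C. compact C \<and> C \<subseteq> span F \<and>
           (\<forall>v\<in>span (X \<union> F). norm v \<le> 1 \<longrightarrow> (\<exists>e\<in>C. v - e \<in> X))"
  using F
proof induction
  case empty
  have "\<forall>v\<in>span X. v \<in> X" using X span_minimal[of X X] by (auto simp: closed_subspace_def)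
  then show ?case by (intro exI[of _ "{0}"]) simp
next
  case (insert y F)
  then obtain C where C: "compact C" "C \<subseteq> span F"
    "\<And>v. v \<in> span (X \<union> F) \<Longrightarrow> norm v \<le> 1 \<Longrightarrow> \<exists>e\<in>C. v - e \<in> X" by blast
  let ?V = "span (X \<union> F)"
  have subX: "subspace X" using X by (simp add: closed_subspace_def)
  have mono: "span F \<subseteq> span (insert y F)" by (intro span_mono) auto
  show ?case
  proof (cases "y \<in> ?V")
    case True
    then have "span (X \<union> insert y F) = ?V" by (simp add: span_redundant)
    with C mono show ?thesis by (intro exI[of _ C]) auto
  next
    case False
    have "closed ?V" by (rule closed_of_compact_representatives[OF X C])
    moreover have ne: "?V \<noteq> {}" using span_zero by blast
    ultimately have "infdist y ?V \<noteq> 0" using False in_closed_iff_infdist_zero by blast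
    then have d: "infdist y ?V > 0" using infdist_nonneg[of y ?V] by linarith
    define d where "d = infdist y ?V"
    define R where "R = 1 + norm y / d"
    have d0: "d > 0" and R: "R > 0" using d by (auto simp: d_def R_def add_pos_nonneg)
    define C' where "C' = (\<lambda>(e, a). R *\<^sub>R e + scale a y) ` (C \<times> cball 0 (1 / d))"
    have bl: "bounded_linear (\<lambda>a. scale a y)"
      by (rule bounded_linear_intro[where K = "norm y"])
        (auto simp: scale_left_distrib norm_scale scaleR_conv_of_real simp flip: scale_of_real)
    have "compact C'"
      unfolding C'_def case_prod_beta
      by (intro compact_continuous_image compact_Times C compact_cball_scalars
          continuous_intros bounded_linear.continuous_on[OF bl])
    moreover have "C' \<subseteq> span (insert y F)"
      using C(2) mono by (auto simp: C'_def intro!: span_add scaleR_mem span_scale intro: span_base)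
    moreover have "\<exists>e\<in>C'. v - e \<in> X" if v: "v \<in> span (X \<union> insert y F)" "norm v \<le> 1" for v
    proof -
      obtain a where a: "v - scale a y \<in> ?V" using v(1) by (auto simp: span_breakdown_eq)
      have ad: "norm a * d \<le> 1"
      proof (cases "a = 0")
        case False
        have "scale (- inverse a) (v - scale a y) \<in> ?V" by (rule span_scale[OF a])
        moreover have "scale (- inverse a) (v - scale a y) = y - scale (inverse a) v"
          using False by (simp add: scale_right_diff_distrib)
        ultimately have "d \<le> dist y (y - scale (inverse a) v)"
          unfolding d_def by (intro infdist_le) simp
        then have "d \<le> norm v / norm a"
          by (simp add: dist_norm norm_scale norm_inverse divide_inverse mult.commute)
        then have "norm a * d \<le> norm v" using False by (simp add: field_simps)
        then show ?thesis using v(2) by linarith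
      qed simp
      then have na: "norm a \<le> 1 / d" using d0 by (simp add: field_simps)
      have "norm (v - scale a y) \<le> norm v + norm a * norm y"
        using norm_triangle_ineq4[of v "scale a y"] by (simp add: norm_scale)
      also have "\<dots> \<le> R"
        unfolding R_def using v(2) mult_right_mono[OF na norm_ge_zero[of y]] by simp
      finally have "norm (inverse R *\<^sub>R (v - scale a y)) \<le> 1"
        using R by (simp only: norm_scaleR) (simp add: field_simps)
      moreover have "inverse R *\<^sub>R (v - scale a y) \<in> ?V" using a by (intro scaleR_mem) auto
      ultimately obtain e where e: "e \<in> C" "inverse R *\<^sub>R (v - scale a y) - e \<in> X"
        using C(3) by blast
      have "R *\<^sub>R (inverse R *\<^sub>R (v - scale a y) - e) \<in> X" by (rule scaleR_mem[OF subX e(2)])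
      then have "v - (R *\<^sub>R e + scale a y) \<in> X"
        using R by (simp add: scaleR_right_diff_distrib algebra_simps)
      moreover have "R *\<^sub>R e + scale a y \<in> C'" using e(1) na by (force simp: C'_def)
      ultimately show ?thesis by blast
    qed
    ultimately show ?thesis by blast
  qed
qed

lemma closed_subspace_span_Un_finite:
  assumes "closed_subspace scale X" "finite F"
  shows "closed_subspace scale (span (X \<union> F))"
  using compact_representatives[OF assms] closed_of_compact_representatives[OF assms(1)]
  unfolding closed_subspace_def by (meson subspace_span)

section \<open>Extension by zero on a finite-dimensional complement\<close>

text \<open>
  The constant \<open>2\<close> comes from \<open>\<parallel>x - p\<parallel> \<le> \<parallel>x + k\<parallel> + \<parallel>p + k\<parallel>\<close>, where \<open>k\<close> is a point of a finite net close to
  \<open>e\<close>, and \<open>p \<in> X\<close> depends only on \<open>k\<close> and makes \<open>\<parallel>p + k\<parallel>\<close> almost minimal: both terms are then at most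
  \<open>\<parallel>x + e\<parallel> \<le> 1\<close> up to multiples of the mesh \<open>\<eta>\<close> of the net. Only finitely many vectors \<open>p\<close> occur, so \<open>T\<^sub>j\<close> is small on all of
  them once \<open>j\<close> is large. The condition \<open>X \<inter> span F = 0\<close> makes the representative of \<open>x + e\<close>
  modulo \<open>X\<close> in the compact set equal to \<open>e\<close>.
\<close>

lemma eventually_norm_le_on_finite_extension:
  fixes T :: "nat \<Rightarrow> 'a \<Rightarrow> 'b::real_normed_vector"
  assumes X: "closed_subspace scale X" and F: "finite F" and indep: "X \<inter> span F \<subseteq> {0}"
    and add: "\<And>j x y. x \<in> X \<Longrightarrow> y \<in> X \<Longrightarrow> T j (x + y) = T j x + T j y"
    and scR: "\<And>j r x. x \<in> X \<Longrightarrow> T j (r *\<^sub>R x) = r *\<^sub>R T j x"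
    and bd: "\<And>j x. x \<in> X \<Longrightarrow> norm (T j x) \<le> M * norm x"
    and lim: "\<And>x. x \<in> X \<Longrightarrow> (\<lambda>j. T j x) \<longlonglongrightarrow> 0"
    and M: "M > 0" and \<delta>: "\<delta> > 0"
  shows "\<forall>\<^sub>F j in sequentially. \<forall>x\<in>X. \<forall>e\<in>span F. norm (T j x) \<le> (2 + \<delta>) * M * norm (x + e)"
proof -
  have subX: "subspace X" using X by (simp add: closed_subspace_def)
  obtain C where C: "compact C" "C \<subseteq> span F"
    "\<And>v. v \<in> span (X \<union> F) \<Longrightarrow> norm v \<le> 1 \<Longrightarrow> \<exists>e\<in>C. v - e \<in> X"
    using compact_representatives[OF X F] by blast
  \<comment> \<open>The distance \<open>\<parallel>x - p k\<parallel>\<close> below costs \<open>3 \<eta>\<close>, and the term \<open>T j (p k)\<close> one more.\<close>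
  define \<eta> where "\<eta> = \<delta> / 4"
  have \<eta>: "\<eta> > 0" using \<delta> by (simp add: \<eta>_def)
  have "\<exists>K. finite K \<and> C \<subseteq> (\<Union>k\<in>K. ball k \<eta>)"
    using C(1) \<eta> by (simp add: compact_eq_totally_bounded)
  then obtain K where K: "finite K" "C \<subseteq> (\<Union>k\<in>K. ball k \<eta>)" by (elim exE conjE)
  have "\<exists>x\<in>X. \<forall>x'\<in>X. norm (x + k) \<le> norm (x' + k) + \<eta>" for k
  proof (rule ccontr)
    let ?I = "INF x\<in>X. norm (x + k)"
    assume neg: "\<not> ?thesis"
    have ne: "X \<noteq> {}" using subspace_0[OF subX] by blast
    have below: "bdd_below ((\<lambda>x. norm (x + k)) ` X)" by (intro bdd_belowI[of _ 0]) auto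
    have "?I + \<eta> \<le> norm (x + k)" if "x \<in> X" for x
    proof -
      obtain x' where x': "x' \<in> X" "norm (x' + k) + \<eta> < norm (x + k)"
        using neg \<open>x \<in> X\<close> by (auto simp: not_le)
      have "?I \<le> norm (x' + k)" by (rule cINF_lower[OF below x'(1)])
      with x'(2) show ?thesis by linarith
    qed
    then have "?I + \<eta> \<le> ?I" by (intro cINF_greatest ne) auto
    with \<eta> show False by simp
  qed
  then obtain p where p: "\<And>k. p k \<in> X" "\<And>k x. x \<in> X \<Longrightarrow> norm (p k + k) \<le> norm (x + k) + \<eta>"
    by metis
  have "\<forall>\<^sub>F j in sequentially. \<forall>k\<in>K. norm (T j (p k)) < M * \<eta>"
    using K(1)
  proof (rule eventually_ball_finite, intro ballI)
    fix k
    show "\<forall>\<^sub>F j in sequentially. norm (T j (p k)) < M * \<eta>"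
      using lim[OF p(1), of k] M \<eta> by (simp add: tendsto_iff)
  qed
  then show ?thesis
  proof eventually_elim
    case (elim j)
    have unit: "norm (T j x) \<le> (2 + \<delta>) * M" if x: "x \<in> X" and e: "e \<in> span F"
      and n1: "norm (x + e) \<le> 1" for x e
    proof -
      have "x + e \<in> span (X \<union> F)"
        using x e span_mono[of F "X \<union> F"] by (intro span_add) (auto intro: span_base)
      then obtain e' where e': "e' \<in> C" "x + e - e' \<in> X" using C(3) n1 by blast
      have "x + e - e' - x \<in> X" by (rule subspace_diff[OF subX e'(2) x])
      moreover have "e - e' \<in> span F" using e e'(1) C(2) by (intro span_diff) auto
      ultimately have "e - e' \<in> X \<inter> span F" by simp
      then have "e = e'" using indep by auto
      then obtain k where k: "k \<in> K" "norm (k - e) < \<eta>"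
        using K(2) e'(1) by (auto simp: dist_norm)
      have tri: "norm (x + k) \<le> norm (x + e) + norm (k - e)"
        using norm_triangle_ineq[of "x + e" "k - e"] by simp
      have "norm (x - p k) \<le> norm (x + k) + norm (p k + k)"
        using norm_triangle_ineq4[of "x + k" "p k + k"] by simp
      moreover have "norm (p k + k) \<le> norm (x + k) + \<eta>" by (rule p(2)[OF x])
      ultimately have diff: "norm (x - p k) \<le> 2 + 3 * \<eta>"
        using tri k(2) n1 by linarith
      have xp: "x - p k \<in> X" by (rule subspace_diff[OF subX x p(1)])
      have "T j x = T j (x - p k) + T j (p k)" using add[OF xp p(1)[of k], of j] by simp
      then have "norm (T j x) \<le> norm (T j (x - p k)) + norm (T j (p k))"
        by (simp add: norm_triangle_ineq)
      also have "\<dots> \<le> M * (2 + 3 * \<eta>) + M * \<eta>"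
      proof (rule add_mono)
        show "norm (T j (x - p k)) \<le> M * (2 + 3 * \<eta>)"
          using bd[OF xp, of j] mult_left_mono[OF diff, of M] M by linarith
        show "norm (T j (p k)) \<le> M * \<eta>" using elim k(1) by (auto intro: less_imp_le)
      qed
      also have "\<dots> = (2 + \<delta>) * M" by (simp add: \<eta>_def algebra_simps)
      finally show ?thesis .
    qed
    show ?case
    proof (intro ballI)
      fix x e assume x: "x \<in> X" and e: "e \<in> span F"
      show "norm (T j x) \<le> (2 + \<delta>) * M * norm (x + e)"
      proof (cases "x + e = 0")
        case True
        then have "x = - e" by (simp add: eq_neg_iff_add_eq_0)
        then have "x \<in> X \<inter> span F" using x e span_neg by blast
        then show ?thesis using indep scR[OF x, of j 0] True by auto
      next
        case False
        define r where "r = inverse (norm (x + e))"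
        have r: "r > 0" using False by (simp add: r_def)
        have "norm (T j (r *\<^sub>R x)) \<le> (2 + \<delta>) * M"
        proof (rule unit)
          show "r *\<^sub>R x \<in> X" by (rule scaleR_mem[OF subX x])
          show "r *\<^sub>R e \<in> span F" by (rule scaleR_mem[OF subspace_span e])
          show "norm (r *\<^sub>R x + r *\<^sub>R e) \<le> 1"
            using False r by (simp add: r_def flip: scaleR_add_right)
        qed
        then have "r * norm (T j x) \<le> (2 + \<delta>) * M" using r by (simp add: scR[OF x])
        then show ?thesis using False by (simp add: r_def field_simps)
      qed
    qed
  qed
qed

end

section \<open>Separable quotients and coordinatewise operators\<close>

lemma separable_quotient_dense_sequence:
  fixes s :: "'k::real_or_complex \<Rightarrow> 'a::banach \<Rightarrow> 'a"
  assumes s: "banach_space_over s" and X: "closed_subspace s X" and Y: "Y \<noteq> {}"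
    and sep: "separable_quotient Y X"
  obtains y where "\<And>n::nat. y n \<in> Y"
    "\<And>v \<delta>. v \<in> Y \<Longrightarrow> \<delta> > 0 \<Longrightarrow> \<exists>n. \<exists>x\<in>X. norm (v - (y n + x)) < \<delta>"
proof -
  interpret banach_space_over s by fact
  interpret Metric_space "quotient_space Y X" quotient_dist
    by (rule Metric_space_quotient[OF s X])
  have sub: "subspace X" using X by (simp add: closed_subspace_def)
  obtain D where D: "countable D" "D \<subseteq> quotient_space Y X"
    "mtopology closure_of D = quotient_space Y X"
    using sep by (auto simp: separable_quotient_def separable_space_def)
  have near: "\<exists>B\<in>D. quotient_dist A B < \<delta>" if "A \<in> quotient_space Y X" "\<delta> > 0" for A \<delta>
    using that D(3) by (auto simp: metric_closure_of set_eq_iff)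
  have "quotient_space Y X \<noteq> {}" using Y by (simp add: quotient_space_def)
  then have "D \<noteq> {}" using near[of _ 1] by fastforce
  then have "range (from_nat_into D) = D" using D(1) by (rule range_from_nat_into)
  then obtain d :: "nat \<Rightarrow> 'a set" where d: "range d = D" by blast
  have "\<exists>y\<in>Y. d n = (+) y ` X" for n
    using d D(2) unfolding quotient_space_def by blast
  then obtain y where y: "\<And>n. y n \<in> Y" "\<And>n. d n = (+) (y n) ` X" by metis
  show thesis
  proof
    fix v and \<delta> :: real assume v: "v \<in> Y" and "\<delta> > 0"
    then have "\<exists>B\<in>D. quotient_dist ((+) v ` X) B < \<delta>" by (intro near) (auto simp: quotient_space_def)
    then obtain n where n: "quotient_dist ((+) v ` X) ((+) (y n) ` X) < \<delta>"
      using d y(2) by (metis imageE)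
    define S where "S = {a - b | a b. a \<in> (+) v ` X \<and> b \<in> (+) (y n) ` X}"
    have ne: "S \<noteq> {}" using subspace_0[OF sub] by (auto simp: S_def)
    have "infdist 0 S < \<delta>" using n by (simp add: S_def quotient_dist_def quotient_norm_def)
    then have "(INF u\<in>S. norm u) < \<delta>" by (simp only: infdist_notempty[OF ne] dist_0_norm)
    moreover have "bdd_below (norm ` S)" by (intro bdd_belowI[of _ 0]) auto
    ultimately have "\<exists>u\<in>S. norm u < \<delta>" by (simp only: cINF_less_iff[OF ne])
    then obtain a b where ab: "a \<in> X" "b \<in> X" "norm (v + a - (y n + b)) < \<delta>"
      by (auto simp: S_def)
    have "v + a - (y n + b) = v - (y n + (b - a))" by simp
    with ab subspace_diff[OF sub ab(2,1)] show "\<exists>n. \<exists>x\<in>X. norm (v - (y n + x)) < \<delta>" by metis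
  qed (rule y)
qed

text \<open>
  The norm bound is assumed uniformly in \<open>j\<close>, so that the families \<open>(R j y)\<close> are bounded and the
  same constant bounds the operator into the sum.
\<close>

lemma bounded_operator_c0_sum:
  fixes sz :: "'k::real_or_complex \<Rightarrow> 'z::banach \<Rightarrow> 'z" and R :: "nat \<Rightarrow> 'y::banach \<Rightarrow> 'z"
  assumes sz: "banach_space_over sz" and sy: "banach_space_over sy" and Y: "module.subspace sy Y"
    and R: "\<And>j. bounded_operator sy sz Y (Z j) (R j)"
    and bd: "\<And>j y. y \<in> Y \<Longrightarrow> norm (R j y) \<le> B * norm y"
    and lim: "\<And>y. y \<in> Y \<Longrightarrow> (\<lambda>j. R j y) \<longlonglongrightarrow> 0"
  obtains T' :: "'y \<Rightarrow> (nat, 'z) linf"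
  where "bounded_operator sy (scale_bcontfun sz) Y (c0_sum Z) T'"
    "\<And>y j. y \<in> Y \<Longrightarrow> apply_bcontfun (T' y) (discrete j) = R j y"
    "\<And>y. y \<in> Y \<Longrightarrow> norm (T' y) \<le> B * norm y"
proof -
  interpret y: banach_space_over sy by fact
  define T' where "T' y = (Bcontfun (\<lambda>i. R (of_discrete i) y) :: (nat, 'z) linf)" for y
  have app: "apply_bcontfun (T' y) i = R (of_discrete i) y" if "y \<in> Y" for y i
  proof -
    have "(\<lambda>i. R (of_discrete i) y) \<in> bcontfun"
      using bd[OF that] by (intro bcontfun_normI[of _ "B * norm y"])
        (auto simp: continuous_on_open_vimage open_discrete)
    then show ?thesis by (simp add: T'_def Bcontfun_inverse)
  qed
  have nT: "norm (T' y) \<le> B * norm y" if "y \<in> Y" for y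
    by (rule norm_bound) (simp add: app bd that)
  have R': "\<And>j x y. x \<in> Y \<Longrightarrow> y \<in> Y \<Longrightarrow> R j (x + y) = R j x + R j y"
    "\<And>j c x. x \<in> Y \<Longrightarrow> R j (sy c x) = sz c (R j x)" "\<And>j x. x \<in> Y \<Longrightarrow> R j x \<in> Z j"
    using R unfolding bounded_operator_def by blast+
  show thesis
  proof
    show "bounded_operator sy (scale_bcontfun sz) Y (c0_sum Z) T'"
      unfolding bounded_operator_def
    proof (intro conjI ballI allI)
      show "T' ` Y \<subseteq> c0_sum Z"
        using R'(3) lim by (auto simp: c0_sum_def app discrete_inverse tendsto_norm_zero)
      show "\<exists>B. \<forall>x\<in>Y. norm (T' x) \<le> B * norm x" using nT by blast
    qed (auto intro!: bcontfun_eqI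
        simp: app R' y.subspace_add[OF Y] y.subspace_scale[OF Y] apply_scale_bcontfun[OF sz])
  qed (auto simp: app discrete_inverse nT)
qed

section \<open>Extension of operators into \<open>c\<^sub>0\<close>-sums\<close>

theorem theorem1p1:
  fixes sz :: "'k::real_or_complex \<Rightarrow> 'z::banach \<Rightarrow> 'z"
    and sy :: "'k \<Rightarrow> 'y::banach \<Rightarrow> 'y"
    and Z :: "nat \<Rightarrow> 'z set"
    and X Y :: "'y set"
    and T :: "'y \<Rightarrow> (nat, 'z) linf"
    and \<epsilon> :: real
  assumes "banach_space_over sz" and "\<And>j. closed_subspace sz (Z j)"
    and "\<And>j. injective 1 sz (Z j)"
    and "banach_space_over sy" and "closed_subspace sy X" and "closed_subspace sy Y"
    and "X \<subseteq> Y" and "separable_quotient Y X"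
    and "bounded_operator sy (scale_bcontfun sz) X (c0_sum Z) T"
    and "\<exists>x\<in>X. T x \<noteq> 0"
    and "\<epsilon> > 0"
  shows "\<exists>T'. bounded_operator sy (scale_bcontfun sz) Y (c0_sum Z) T' \<and>
              (\<forall>x\<in>X. T' x = T x) \<and>
              op_norm Y T' < (2 + \<epsilon>) * op_norm X T"
proof -
  note sz = assms(1) and sy = assms(4) and X = assms(5) and Y = assms(6) and XY = assms(7)
    and T = assms(9)
  interpret z: banach_space_over sz by fact
  interpret y: banach_space_over sy by fact
  have subX: "y.subspace X" and subY: "y.subspace Y"
    using X Y by (auto simp: closed_subspace_def)

  define M where "M = op_norm X T"
  have M_le: "norm (T x) \<le> M * norm x" if "x \<in> X" for x
    unfolding M_def by (rule op_norm_bound[OF T that])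
  have M: "M > 0"
  proof -
    obtain x where x: "x \<in> X" "T x \<noteq> 0" using assms(10) by blast
    then have "0 < M * norm x" using M_le[OF x(1)] by (smt (verit) zero_less_norm_iff)
    then show ?thesis by (simp add: zero_less_mult_iff)
  qed

  define t where "t j x = apply_bcontfun (T x) (discrete j)" for j x
  have t_add: "t j (x + y) = t j x + t j y" if "x \<in> X" "y \<in> X" for j x y
    using T that by (simp add: t_def bounded_operator_def)
  have t_sc: "t j (sy c x) = sz c (t j x)" if "x \<in> X" for j c x
    using T that by (simp add: t_def bounded_operator_def apply_scale_bcontfun[OF sz])
  have t_Z: "t j x \<in> Z j" and t_lim: "(\<lambda>j. t j x) \<longlonglongrightarrow> 0" if "x \<in> X" for j x
  proof -
    have "T x \<in> c0_sum Z" using T that by (auto simp: bounded_operator_def)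
    then show "t j x \<in> Z j" "(\<lambda>j. t j x) \<longlonglongrightarrow> 0"
      by (simp_all add: c0_sum_def t_def tendsto_norm_zero_iff)
  qed
  have t_le: "norm (t j x) \<le> M * norm x" if "x \<in> X" for j x
    using norm_bounded[of "T x" "discrete j"] M_le[OF that] by (simp add: t_def)

  \<comment> \<open>\<open>Q\<close> is merely algebraic and may be unbounded; it serves to make the extensions by zero on
    the spaces \<open>span (E n)\<close> compatible with each other.\<close>
  obtain Q where Q: "\<And>v. Q v \<in> X" "Vector_Spaces.linear sy sy Q" "\<And>x. x \<in> X \<Longrightarrow> Q x = x"
  proof -
    interpret yy: vector_space_pair sy sy by unfold_locales
    have "Vector_Spaces.linear sy sy (\<lambda>v. v)" by (rule y.linear_ident)
    from yy.linear_exists_left_inverse_on[OF this subX] show thesis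
      using that by (auto simp: inj_on_def)
  qed
  interpret Q: Vector_Spaces.linear sy sy Q by (rule Q)

  obtain y where y: "\<And>n::nat. y n \<in> Y"
    "\<And>v \<delta>. v \<in> Y \<Longrightarrow> \<delta> > 0 \<Longrightarrow> \<exists>n. \<exists>x\<in>X. norm (v - (y n + x)) < \<delta>"
    using separable_quotient_dense_sequence[OF sy X _ assms(8)] y.subspace_0[OF subY] by blast
  define e where "e n = y n - Q (y n)" for n
  have Qe: "Q (e n) = 0" for n by (simp add: e_def Q.diff Q)
  have eY: "e n \<in> Y" for n
    unfolding e_def using y(1) Q(1) XY by (intro y.subspace_diff[OF subY]) auto
  define E where "E n = e ` {..<n}" for n
  have Q_E: "Q v = 0" if "v \<in> y.span (E n)" for v n
    using that by (rule Q.eq_0_on_span[rotated]) (auto simp: E_def Qe)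
  have indep: "X \<inter> y.span (E n) \<subseteq> {0}" for n using Q_E Q(3) by force
  define W where "W n = y.span (X \<union> E n)" for n
  have clW: "closed_subspace sy (W n)" for n
    unfolding W_def E_def by (intro y.closed_subspace_span_Un_finite X) auto
  have WY: "W n \<subseteq> Y" for n
    unfolding W_def E_def using XY eY by (intro y.span_minimal subY) auto
  have XW: "X \<subseteq> W n" for n unfolding W_def using y.span_superset by blast
  have W_mono: "W m \<subseteq> W n" if "m \<le> n" for m n
    unfolding W_def E_def using that by (intro y.span_mono) auto
  have W_dense: "\<exists>n. \<exists>w\<in>W n. norm (v - w) < \<delta>" if v: "v \<in> Y" "\<delta> > 0" for v \<delta>
  proof -
    obtain n x where nx: "x \<in> X" "norm (v - (y n + x)) < \<delta>" using y(2)[OF v] by blast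
    have "y n + x = e n + (Q (y n) + x)" by (simp add: e_def)
    moreover have "e n \<in> W (Suc n)"
      unfolding W_def E_def by (intro y.span_base) auto
    moreover have "Q (y n) + x \<in> W (Suc n)"
      using XW y.subspace_add[OF subX Q(1) nx(1)] by blast
    ultimately have "y n + x \<in> W (Suc n)"
      using clW[of "Suc n"] unfolding closed_subspace_def by (metis y.subspace_add)
    with nx show ?thesis by blast
  qed

  define B where "B = (2 + \<epsilon> / 2) * M"
  have B: "M \<le> B" "0 \<le> B" using M \<open>\<epsilon> > 0\<close> by (auto simp: B_def algebra_simps)
  \<comment> \<open>As \<open>good 0 j\<close> always holds, the maximum \<open>N j\<close> below exists for every \<open>j\<close>; the restriction \<open>n \<le> j\<close>
    keeps it finite.\<close>
  define good where "good n j \<longleftrightarrow> (\<forall>w\<in>W n. norm (t j (Q w)) \<le> B * norm w)" for n j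
  have good_0: "good 0 j" for j
  proof -
    have "W 0 = X" using subX by (simp add: W_def E_def)
    moreover have "norm (t j x) \<le> B * norm x" if "x \<in> X" for x
      using t_le[OF that, of j] mult_right_mono[OF B(1) norm_ge_zero[of x]] by linarith
    ultimately show ?thesis by (simp add: good_def Q(3))
  qed
  have good_ev: "\<forall>\<^sub>F j in sequentially. good n j" for n
  proof -
    have "\<forall>\<^sub>F j in sequentially. \<forall>x\<in>X. \<forall>v\<in>y.span (E n).
        norm (t j x) \<le> (2 + \<epsilon> / 2) * M * norm (x + v)"
    proof (rule y.eventually_norm_le_on_finite_extension[OF X _ indep t_add _ t_le t_lim M])
      show "t j (r *\<^sub>R x) = r *\<^sub>R t j x" if "x \<in> X" for j r x
        using t_sc[OF that, of j "of_real r"] by (simp add: y.scale_of_real z.scale_of_real)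
    qed (use \<open>\<epsilon> > 0\<close> in \<open>auto simp: E_def\<close>)
    then show ?thesis
    proof eventually_elim
      case (elim j)
      show ?case
        unfolding good_def
      proof
        fix w assume "w \<in> W n"
        then obtain x v where "x \<in> y.span X" and v: "v \<in> y.span (E n)" and w: "w = x + v"
          unfolding W_def y.span_Un by auto
        then have x: "x \<in> X" using y.span_minimal[OF order_refl subX] by blast
        then have "Q w = x" by (simp add: w Q.add Q(3) Q_E[OF v])
        then show "norm (t j (Q w)) \<le> B * norm w" using elim x v by (simp add: B_def w)
      qed
    qed
  qed
  define N where "N j = Max {n. n \<le> j \<and> good n j}" for j
  have N: "good (N j) j" "\<And>n. n \<le> j \<Longrightarrow> good n j \<Longrightarrow> n \<le> N j" for j
  proof -
    have fin: "finite {n. n \<le> j \<and> good n j}" by (rule finite_subset[of _ "{..j}"]) auto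
    show "n \<le> N j" if "n \<le> j" "good n j" for n
      unfolding N_def using that by (intro Max_ge fin) auto
    have "N j \<in> {n. n \<le> j \<and> good n j}"
      unfolding N_def using good_0 by (intro Max_in fin) auto
    then show "good (N j) j" by simp
  qed
  have N_ev: "\<forall>\<^sub>F j in sequentially. n \<le> N j" for n
    using good_ev[of n] eventually_ge_at_top[of n] by eventually_elim (rule N)

  have "\<exists>R. bounded_operator sy sz Y (Z j) R \<and> (\<forall>w\<in>W (N j). R w = t j (Q w)) \<and>
      (\<forall>v\<in>Y. norm (R v) \<le> B * norm v)" for j
  proof -
    have op: "bounded_operator sy sz (W (N j)) (Z j) (\<lambda>w. t j (Q w))"
      unfolding bounded_operator_def using N(1)[of j]
      by (auto simp: Q.add Q.scale t_add t_sc t_Z Q(1) good_def)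
    have le: "op_norm (W (N j)) (\<lambda>w. t j (Q w)) \<le> B"
      using N(1)[of j] B XW[of "N j"] y.subspace_0[OF subX]
      by (intro op_norm_least) (auto simp: good_def)
    obtain R where R: "bounded_operator sy sz Y (Z j) R" "\<And>w. w \<in> W (N j) \<Longrightarrow> R w = t j (Q w)"
      "op_norm Y R \<le> 1 * op_norm (W (N j)) (\<lambda>w. t j (Q w))"
      using injective_extension[OF sz assms(2,3) _ sy clW Y WY op] by auto
    have "norm (R v) \<le> B * norm v" if "v \<in> Y" for v
    proof -
      have "norm (R v) \<le> op_norm Y R * norm v" by (rule op_norm_bound[OF R(1) that])
      also have "\<dots> \<le> B * norm v" using R(3) le by (intro mult_right_mono) auto
      finally show ?thesis .
    qed
    with R show ?thesis by blast
  qed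
  then obtain R where R: "\<And>j. bounded_operator sy sz Y (Z j) (R j)"
    "\<And>j w. w \<in> W (N j) \<Longrightarrow> R j w = t j (Q w)" "\<And>j v. v \<in> Y \<Longrightarrow> norm (R j v) \<le> B * norm v"
    by metis

  have lim: "(\<lambda>j. R j v) \<longlonglongrightarrow> 0" if v: "v \<in> Y" for v
  proof (rule tendstoI)
    fix \<delta> :: real assume \<delta>: "\<delta> > 0"
    define \<gamma> where "\<gamma> = \<delta> / (2 * (B + 1))"
    have "\<gamma> > 0" using \<delta> B(2) by (simp add: \<gamma>_def)
    then obtain n w where w: "w \<in> W n" "norm (v - w) < \<gamma>" using W_dense[OF v] by blast
    have wY: "w \<in> Y" and vwY: "v - w \<in> Y"
      using WY w(1) v y.subspace_diff[OF subY] by blast+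
    have "B * norm (v - w) \<le> (B + 1) * \<gamma>" using w(2) B(2) by (intro mult_mono) auto
    also have "\<dots> = \<delta> / 2" using B(2) by (simp add: \<gamma>_def field_simps)
    finally have small: "norm (R j (v - w)) \<le> \<delta> / 2" for j
      using R(3)[OF vwY, of j] by linarith
    have "\<forall>\<^sub>F j in sequentially. norm (t j (Q w)) < \<delta> / 2"
      using tendstoD[OF t_lim[OF Q(1), of w], of "\<delta> / 2"] \<delta> by simp
    then show "\<forall>\<^sub>F j in sequentially. dist (R j v) 0 < \<delta>"
      using N_ev[of n]
    proof eventually_elim
      case (elim j)
      have "R j ((v - w) + w) = R j (v - w) + R j w"
        using R(1)[of j] vwY wY by (simp only: bounded_operator_def)
      moreover have "R j w = t j (Q w)" using R(2) W_mono[OF elim(2)] w(1) by blast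
      ultimately show ?case
        using small[of j] elim(1) norm_triangle_ineq[of "R j (v - w)" "R j w"] by simp
    qed
  qed

  obtain T' where T': "bounded_operator sy (scale_bcontfun sz) Y (c0_sum Z) T'"
    "\<And>v j. v \<in> Y \<Longrightarrow> apply_bcontfun (T' v) (discrete j) = R j v"
    "\<And>v. v \<in> Y \<Longrightarrow> norm (T' v) \<le> B * norm v"
    using bounded_operator_c0_sum[OF sz sy subY R(1,3) lim] by blast
  show ?thesis
  proof (intro exI[of _ T'] conjI ballI)
    show "T' x = T x" if x: "x \<in> X" for x
    proof (rule bcontfun_eqI)
      fix i :: "nat discrete"
      obtain j where i: "i = discrete j" by (metis of_discrete_inverse)
      have "apply_bcontfun (T' x) i = R j x" using T'(2) x XY by (auto simp: i)
      also have "\<dots> = t j x" using R(2)[of x j] XW x Q(3) by auto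
      finally show "apply_bcontfun (T' x) i = apply_bcontfun (T x) i" by (simp add: t_def i)
    qed
    have "op_norm Y T' \<le> B"
      using y.subspace_0[OF subY] B(2) T'(3) by (intro op_norm_least) auto
    also have "B < (2 + \<epsilon>) * M" using M \<open>\<epsilon> > 0\<close> by (simp add: B_def)
    finally show "op_norm Y T' < (2 + \<epsilon>) * op_norm X T" by (simp add: M_def)
  qed (rule T')
qed

end
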